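(* Let $f\in\mathrm{H}(\mathbb{D})$, $S,T\in\mathrm{Aut}(\mathbb{D})$, $j\ge 1$ and $z_0,\dots,z_{j-1},z\in\mathbb{D}$. Then $$(S\circ f\circ T)_j(z;z_{j-1},\dots,z_0)=\frac{S'(f(T(z_0)))}{|S'(f(T(z_0)))|}\cdot f_j(T(z);T(z_{j-1}),\dots,T(z_0))\cdot\prod_{k=0}^{j-1}\frac{T'(z_k)}{|T'(z_k)|}.$$ In particular, $$|(S\circ f\circ T)_j(z;z_{j-1},\dots,z_0)|=|f_j(T(z);T(z_{j-1}),\dots,T(z_0))|.$$
   Context: $\mathbb{D}=\{z\in\mathbb{C}:|z|<1\}$; $\mathrm{H}(\mathbb{D})$ is the set of holomorphic functions $f$ on $\mathbb{D}$ with $|f|\le 1$; $\mathrm{Aut}(\mathbb{D})$ is the group of conformal automorphisms of $\mathbb{D}$ (its elements are Möbius transformations, regarded as defined on $\overline{\mathbb{D}}$ too, so that $S\circ f$ makes sense for all $f\in \mathrm{H}(\mathbb{D})$). For $z,w\in\mathbb{D}$ put $[z,w]=\dfrac{z-w}{1-\overline{w}z}$, and put $[z,z]=0$ for $z\in\partial\mathbb{D}$. For $f\in\mathrm{H}(\mathbb{D})$ and $z_0\in\mathbb{D}$ define $\Delta_{z_0}f\in\mathrm{H}(\mathbb{D})$ by $\Delta_{z_0}f(z)=\dfrac{[f(z),f(z_0)]}{[z,z_0]}$ for $z\neq z_0$ and $\Delta_{z_0}f(z_0)=\dfrac{(1-|z_0|^2)f'(z_0)}{1-|f(z_0)|^2}$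 (if $f$ is a unimodular constant, $\Delta_{z_0}f\equiv 0$). It is known from the Schwarz–Pick lemma that $\Delta_{z_0}$ maps $\mathrm{H}(\mathbb{D})$ into itself. For points $z_0,z_1,\dots\in\mathbb{D}$ (not necessarily distinct) define $f_j(z;z_{j-1},\dots,z_0)=(\Delta_{z_{j-1}}\circ\cdots\circ\Delta_{z_0})f(z)$, with $f_0(z)=f(z)$ for $j=0$. *)

theory Defs
  imports "HOL-Complex_Analysis.Complex_Analysis"
begin

text \<open>Functions on the unit disc are total functions \<open>complex \<Rightarrow> complex\<close>; for members of
  \<open>H_disc\<close> only the values on \<open>ball 0 1\<close> matter.\<close>

definition H_disc :: "(complex \<Rightarrow> complex) set" where
  "H_disc = {f. f holomorphic_on ball 0 1 \<and> (\<forall>z\<in>ball 0 1. norm (f z) \<le> 1)}"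

text \<open>A conformal automorphism of the open disc is a Moebius transformation, regarded as
  defined on the closed disc as well. Analyticity on \<open>cball 0 1\<close> (that is, in a
  neighbourhood of it) selects this extension and makes \<open>deriv S\<close> its derivative also at
  boundary points, where \<open>S \<circ> f\<close> needs it if \<open>f\<close> is a unimodular constant.\<close>

definition Aut_disc :: "(complex \<Rightarrow> complex) set" where
  "Aut_disc = {S. S analytic_on cball 0 1 \<and> bij_betw S (ball 0 1) (ball 0 1)}"

text \<open>For \<open>z = w\<close> on the unit circle, the convention \<open>0 / 0 = 0\<close> gives the required
  value \<open>0\<close>.\<close>

definition bracket :: "complex \<Rightarrow> complex \<Rightarrow> complex" where
  "bracket z w = (z - w) / (1 - cnj w * z)"

text \<open>If \<open>f\<close> is a unimodular constant on the disc, both branches are \<open>0\<close> for \<open>z\<close> in the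
  disc, as required: the first since \<open>deriv f z\<^sub>0 = 0\<close>, the second by the value of
  \<open>bracket\<close> on the diagonal.\<close>

definition hyp_diff :: "complex \<Rightarrow> (complex \<Rightarrow> complex) \<Rightarrow> complex \<Rightarrow> complex" where
  "hyp_diff z\<^sub>0 f z =
     (if z = z\<^sub>0
      then of_real (1 - (norm z\<^sub>0)\<^sup>2) * deriv f z\<^sub>0 / of_real (1 - (norm (f z\<^sub>0))\<^sup>2)
      else bracket (f z) (f z\<^sub>0) / bracket z z\<^sub>0)"

text \<open>\<open>hyp_diffs f p j z\<close> is \<open>f\<^sub>j(z; p (j - 1), \<dots>, p 0)\<close>; only the first \<open>j\<close> points
  of the sequence \<open>p\<close> are used.\<close>

primrec hyp_diffs ::
    "(complex \<Rightarrow> complex) \<Rightarrow> (nat \<Rightarrow> complex) \<Rightarrow> nat \<Rightarrow> complex \<Rightarrow> complex" where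
  "hyp_diffs f p 0 = f"
| "hyp_diffs f p (Suc j) = hyp_diff (p j) (hyp_diffs f p j)"

end

theory Submission
  imports Defs
begin

text \<open>An automorphism \<open>S\<close> of the disc has the form \<open>S z = c * bracket z a\<close> with \<open>norm a < 1\<close> and
  \<open>norm c = 1\<close>. For such maps a direct computation shows that the bracket is invariant up to
  the phase of the derivative, \<open>bracket (S z) (S w) = sgn (deriv S w) * bracket z w\<close>
  (\<open>bracket_Aut_disc\<close>), and that \<open>1 - (norm (S w))\<^sup>2 = norm (deriv S w) * (1 - (norm w)\<^sup>2)\<close>. Both
  identities hold on the closed disc.

  They give the case of one difference quotient, \<open>hyp_diff_Aut_disc\<close>: composing with \<open>S\<close> on the
  left and \<open>T\<close> on the right multiplies the quotient by the phases of \<open>deriv S\<close> and \<open>deriv T\<close>.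
  After the first step the function on the left has become a unimodular constant times a
  function composed with \<open>T\<close>. Multiplication by a unimodular constant is again an automorphism,
  a rotation, and the phase of its derivative is the constant itself. So the same lemma carries
  the induction: the constant is passed on unchanged, and each step contributes one phase of
  \<open>deriv T\<close>.

  The induction requires that the iterated quotients are again in \<open>H_disc\<close>. This is the
  Schwarz--Pick lemma (\<open>hyp_diff_in_H_disc\<close>), which the one-step identity reduces to the
  Schwarz lemma.\<close>

section \<open>Automorphisms of the disc\<close>

lemma of_real_norm_squared: "(complex_of_real (norm z))\<^sup>2 = z * cnj z"
  using complex_norm_square[of z] by simp

lemma one_minus_cnj_mult_nonzero:
  fixes a z :: complex
  assumes "norm a < 1" and "norm z \<le> 1"
  shows "1 - cnj a * z \<noteq> 0"
proof -
  have "norm (cnj a * z) \<le> norm a * 1"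
    unfolding norm_mult complex_mod_cnj by (intro mult_left_mono assms) auto
  then show ?thesis
    using assms(1) by auto
qed

lemma bracket_eq_Moebius_function: "(\<lambda>z. bracket z a) = Moebius_function 0 a"
  by (simp add: fun_eq_iff bracket_def Moebius_function_simple)

lemma bracket_analytic:
  assumes "norm a < 1"
  shows "(\<lambda>z. bracket z a) analytic_on cball 0 1"
  unfolding bracket_def
  using one_minus_cnj_mult_nonzero[OF assms] by (intro analytic_intros) auto

lemma bracket_in_Aut_disc:
  assumes "norm a < 1"
  shows "(\<lambda>z. bracket z a) \<in> Aut_disc"
proof -
  have "bij_betw (\<lambda>z. bracket z a) (ball 0 1) (ball 0 1)"
    unfolding bracket_eq_Moebius_function
    by (rule bij_betw_byWitness[where f' = "Moebius_function 0 (- a)"])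
       (use assms Moebius_function_compose Moebius_function_norm_lt_1 in auto)
  with bracket_analytic[OF assms] show ?thesis
    by (simp add: Aut_disc_def)
qed

lemma rotation_in_Aut_disc:
  assumes "norm c = 1"
  shows "(\<lambda>z. c * z) \<in> Aut_disc"
proof -
  have "c \<noteq> 0"
    using assms by auto
  then have "bij_betw (\<lambda>z. c * z) (ball 0 1) (ball 0 1)"
    by (intro bij_betw_byWitness[where f' = "\<lambda>z. z / c"])
       (use assms in \<open>auto simp: norm_mult norm_divide\<close>)
  then show ?thesis
    by (auto simp: Aut_disc_def intro!: analytic_intros)
qed

lemma Aut_disc_ball: "S \<in> Aut_disc \<Longrightarrow> z \<in> ball 0 1 \<Longrightarrow> S z \<in> ball 0 1"
  unfolding Aut_disc_def using bij_betwE by blast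

lemma Aut_disc_holomorphic: "S \<in> Aut_disc \<Longrightarrow> S holomorphic_on ball 0 1"
  using analytic_on_subset[of S "cball 0 1" "ball 0 1"]
  by (simp add: Aut_disc_def analytic_imp_holomorphic)

lemma Aut_disc_has_field_derivative:
  assumes "S \<in> Aut_disc" and "z \<in> cball 0 1"
  shows "(S has_field_derivative deriv S z) (at z)"
proof -
  have "S analytic_on {z}"
    using assms analytic_on_subset[of S "cball 0 1" "{z}"] by (auto simp: Aut_disc_def)
  then show ?thesis
    by (simp add: analytic_on_imp_differentiable_at DERIV_deriv_iff_field_differentiable)
qed

lemma has_field_derivative_bracket:
  assumes "norm a < 1" and "norm z \<le> 1"
  shows "((\<lambda>z. bracket z a) has_field_derivative (1 - (norm a)\<^sup>2) / (1 - cnj a * z)\<^sup>2) (at z)"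
proof -
  have "1 - cnj a * z \<noteq> 0"
    by (rule one_minus_cnj_mult_nonzero[OF assms])
  then have "((\<lambda>z. bracket z a) has_field_derivative
      ((1 - 0) * (1 - cnj a * z) - (z - a) * (0 - cnj a * 1)) / ((1 - cnj a * z) * (1 - cnj a * z))) (at z)"
    unfolding bracket_def by (auto intro!: derivative_eq_intros)
  moreover have "(1 - 0) * (1 - cnj a * z) - (z - a) * (0 - cnj a * 1) = of_real (1 - (norm a)\<^sup>2)"
    by (simp add: of_real_norm_squared algebra_simps)
  ultimately show ?thesis
    unfolding power2_eq_square[of "1 - cnj a * z"] by metis
qed

text \<open>If \<open>S a = 0\<close>, then \<open>S\<close> precomposed with the Moebius map taking \<open>0\<close> to \<open>a\<close> fixes \<open>0\<close>.
  The Schwarz lemma for this map and for its inverse gives equality in the Schwarz lemma, so it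
  is a rotation.\<close>

lemma Aut_disc_eq_bracket_on_ball:
  assumes S: "S \<in> Aut_disc"
  obtains a c where "norm a < 1" "norm c = 1" "\<And>z. z \<in> ball 0 1 \<Longrightarrow> S z = c * bracket z a"
proof -
  let ?D = "ball 0 1 :: complex set"
  have bij: "bij_betw S ?D ?D"
    using S by (simp add: Aut_disc_def)
  then obtain a where a: "a \<in> ?D" and Sa: "S a = 0"
    by (metis (no_types, lifting) bij_betw_iff_bijections centre_in_ball zero_less_one)
  have holS: "S holomorphic_on ?D"
    by (rule Aut_disc_holomorphic[OF S])
  obtain R where holR: "R holomorphic_on S ` ?D" and RS: "\<And>z. z \<in> ?D \<Longrightarrow> R (S z) = z"
    using holomorphic_has_inverse[OF holS open_ball bij_betw_imp_inj_on[OF bij]] by metis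
  have imS: "S ` ?D = ?D"
    using bij by (simp add: bij_betw_def)
  have Rball: "R z \<in> ?D" if "z \<in> ?D" for z
    using that RS imS by (metis imageE)
  define M where "M = Moebius_function 0 a"
  define N where "N = Moebius_function 0 (- a)"
  have holM: "M holomorphic_on ?D" and holN: "N holomorphic_on ?D"
    and Mball: "\<And>z. z \<in> ?D \<Longrightarrow> M z \<in> ?D" and Nball: "\<And>z. z \<in> ?D \<Longrightarrow> N z \<in> ?D"
    and MN: "\<And>z. z \<in> ?D \<Longrightarrow> M (N z) = z" and NM: "\<And>z. z \<in> ?D \<Longrightarrow> N (M z) = z"
    using a Moebius_function_holomorphic Moebius_function_norm_lt_1 Moebius_function_compose
    by (auto simp: M_def N_def)
  have holSN: "(S \<circ> N) holomorphic_on ?D"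
    by (rule holomorphic_on_compose_gen[OF holN holS]) (use Nball in auto)
  have holMR: "(M \<circ> R) holomorphic_on ?D"
    by (rule holomorphic_on_compose_gen[OF _ holM]) (use holR imS Rball in auto)
  have SN0: "(S \<circ> N) 0 = 0"
    by (simp add: N_def Moebius_function_of_zero Sa)
  have "R 0 = a"
    using RS[OF a] Sa by simp
  then have MR0: "(M \<circ> R) 0 = 0"
    by (simp add: M_def Moebius_function_eq_zero)
  have SNb: "norm ((S \<circ> N) z) < 1" and MRb: "norm ((M \<circ> R) z) < 1" if "norm z < 1" for z
    using that Nball Mball Rball Aut_disc_ball[OF S] by auto
  \<comment> \<open>Equality at a single point other than the origin is enough; \<open>1/2\<close> is an arbitrary choice.\<close>
  have "norm ((S \<circ> N) (1/2)) = norm (1/2 :: complex)"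
  proof (rule antisym)
    show "norm ((S \<circ> N) (1/2)) \<le> norm (1/2 :: complex)"
      by (rule Schwarz_Lemma(1)[OF holSN SN0 SNb]) auto
    have eq: "(M \<circ> R) ((S \<circ> N) (1/2)) = 1/2"
      using RS[OF Nball, of "1/2"] MN[of "1/2"] by simp
    have "norm ((S \<circ> N) (1/2)) < 1"
      by (rule SNb) simp
    from Schwarz_Lemma(1)[OF holMR MR0 MRb this]
    show "norm (1/2 :: complex) \<le> norm ((S \<circ> N) (1/2))"
      unfolding eq .
  qed
  then have "\<exists>z. norm z < 1 \<and> z \<noteq> 0 \<and> norm ((S \<circ> N) z) = norm z"
    by (intro exI[of _ "1/2"]) auto
  then obtain c where c: "\<And>z. norm z < 1 \<Longrightarrow> (S \<circ> N) z = c * z" "norm c = 1"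
    using Schwarz_Lemma(3)[OF holSN SN0 SNb, of 0] by auto
  have "S z = c * bracket z a" if "z \<in> ?D" for z
    using c(1)[of "M z"] Mball[OF that] NM[OF that]
    by (simp add: M_def flip: bracket_eq_Moebius_function)
  with a c(2) that show ?thesis
    by auto
qed

text \<open>Both \<open>S\<close> and \<open>deriv S\<close> are continuous on the closed disc, so the formulas persist on the
  unit circle; there they are needed for \<open>S \<circ> f\<close> with \<open>f\<close> a unimodular constant.\<close>

lemma Aut_disc_Moebius_form:
  assumes S: "S \<in> Aut_disc"
  obtains a c where "norm a < 1" "norm c = 1"
    "\<And>z. z \<in> cball 0 1 \<Longrightarrow> S z = c * bracket z a"
    "\<And>z. z \<in> cball 0 1 \<Longrightarrow> deriv S z = c * ((1 - (norm a)\<^sup>2) / (1 - cnj a * z)\<^sup>2)"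
proof -
  obtain a c where a: "norm a < 1" and c: "norm c = 1"
    and eq: "\<And>z. z \<in> ball 0 1 \<Longrightarrow> S z = c * bracket z a"
    using Aut_disc_eq_bracket_on_ball[OF S] by metis
  define D where "D z = c * ((1 - (norm a)\<^sup>2) / (1 - cnj a * z)\<^sup>2)" for z
  have anS: "S analytic_on cball 0 1"
    using S by (simp add: Aut_disc_def)
  have cont: "continuous_on (cball 0 1) S" "continuous_on (cball 0 1) (deriv S)"
    using anS analytic_deriv[OF anS]
    by (simp_all add: analytic_imp_holomorphic holomorphic_on_imp_continuous_on)
  have contM: "continuous_on (cball 0 1) (\<lambda>z. bracket z a)"
    using bracket_analytic[OF a]
    by (simp add: analytic_imp_holomorphic holomorphic_on_imp_continuous_on)
  have contD: "continuous_on (cball 0 1) D"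
    unfolding D_def by (intro continuous_intros) (use one_minus_cnj_mult_nonzero[OF a] in auto)
  have eqD: "deriv S z = D z" if "z \<in> ball 0 1" for z
  proof -
    have "((\<lambda>z. c * bracket z a) has_field_derivative D z) (at z)"
      unfolding D_def using that a by (intro DERIV_cmult has_field_derivative_bracket) auto
    then have "(S has_field_derivative D z) (at z)"
      by (rule has_field_derivative_transform_within_open[OF _ open_ball that]) (simp add: eq)
    then show ?thesis
      by (rule DERIV_imp_deriv)
  qed
  have "S z - c * bracket z a = 0" if "z \<in> cball 0 1" for z
    by (rule continuous_constant_on_closure[where S = "ball 0 1"])
       (use that eq in \<open>auto intro!: continuous_intros cont contM\<close>)
  moreover have "deriv S z - D z = 0" if "z \<in> cball 0 1" for z
    by (rule continuous_constant_on_closure[where S = "ball 0 1"])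
       (use that eqD in \<open>auto intro!: continuous_intros cont contD\<close>)
  ultimately show ?thesis
    using that[of a c] a c by (simp add: D_def)
qed

section \<open>Invariance of the bracket\<close>

lemma bracket_diff:
  fixes a z w :: complex
  assumes "norm a < 1" and "norm z \<le> 1" and "norm w \<le> 1"
  shows "bracket z a - bracket w a =
    (1 - (norm a)\<^sup>2) * (z - w) / ((1 - cnj a * z) * (1 - cnj a * w))"
  using one_minus_cnj_mult_nonzero[OF assms(1,2)] one_minus_cnj_mult_nonzero[OF assms(1,3)]
  unfolding bracket_def by (simp add: of_real_norm_squared divide_simps) (simp add: algebra_simps)

lemma one_minus_cnj_bracket_mult_bracket:
  assumes "norm a < 1" and "norm z \<le> 1" and "norm w \<le> 1"
  shows "1 - cnj (bracket w a) * bracket z a =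
    (1 - (norm a)\<^sup>2) * (1 - cnj w * z) / ((1 - cnj a * z) * cnj (1 - cnj a * w))"
proof -
  have "cnj (1 - cnj a * w) \<noteq> 0"
    using one_minus_cnj_mult_nonzero[OF assms(1,3)] complex_cnj_zero_iff by blast
  then show ?thesis
    using one_minus_cnj_mult_nonzero[OF assms(1,2)]
    unfolding bracket_def by (simp add: of_real_norm_squared divide_simps) (simp add: algebra_simps)
qed

text \<open>For \<open>S z = c * bracket z a\<close> the two preceding identities give the unimodular factor
  \<open>c * cnj d / d\<close> with \<open>d = 1 - cnj a * w\<close>. Since \<open>deriv S w\<close> is a positive multiple of
  \<open>c / d\<^sup>2\<close>, this factor is its phase.\<close>

lemma bracket_Aut_disc:
  assumes S: "S \<in> Aut_disc" and z: "z \<in> cball 0 1" and w: "w \<in> cball 0 1"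
  shows "bracket (S z) (S w) = sgn (deriv S w) * bracket z w"
proof -
  obtain a c where a: "norm a < 1" and c: "norm c = 1"
    and eq: "\<And>z. z \<in> cball 0 1 \<Longrightarrow> S z = c * bracket z a"
    and deq: "\<And>z. z \<in> cball 0 1 \<Longrightarrow> deriv S z = c * ((1 - (norm a)\<^sup>2) / (1 - cnj a * z)\<^sup>2)"
    using Aut_disc_Moebius_form[OF S] by metis
  define N where "N = 1 - (norm a)\<^sup>2"
  define d where "d = 1 - cnj a * w"
  define e where "e = 1 - cnj a * z"
  have N: "N > 0"
    using a by (simp add: N_def power_less_one_iff)
  have de: "d \<noteq> 0" "e \<noteq> 0"
    using one_minus_cnj_mult_nonzero[OF a] z w by (auto simp: d_def e_def)
  have cc: "cnj c * c = 1"
    using c complex_norm_square[of c] by (simp add: mult.commute)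
  have "sgn (deriv S w) = c * cnj d / d"
  proof -
    have "of_real ((norm d)\<^sup>2) = d * cnj d"
      by (rule complex_norm_square)
    then show ?thesis
      using N de c unfolding deq[OF w] d_def[symmetric] N_def[symmetric]
      by (simp add: sgn_eq norm_mult norm_divide norm_power power2_eq_square divide_simps)
  qed
  moreover have "bracket (S z) (S w) = c * cnj d / d * bracket z w"
  proof -
    have num: "S z - S w = c * (N * (z - w) / (e * d))"
      using bracket_diff[OF a, of z w] z w
      by (simp add: eq N_def d_def e_def flip: right_diff_distrib)
    have den: "1 - cnj (S w) * S z = N * (1 - cnj w * z) / (e * cnj d)"
    proof -
      have "1 - cnj (S w) * S z = 1 - (cnj c * c) * (cnj (bracket w a) * bracket z a)"
        using z w by (simp add: eq mult_ac)
      then show ?thesis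
        using one_minus_cnj_bracket_mult_bracket[OF a, of z w] z w
        by (simp add: cc N_def d_def e_def)
    qed
    \<comment> \<open>If \<open>1 - cnj w * z = 0\<close>, both sides are quotients by zero and hence \<open>0\<close>.\<close>
    show ?thesis
      unfolding bracket_def num den using N de
      by (cases "1 - cnj w * z = 0") (simp_all add: divide_simps)
  qed
  ultimately show ?thesis
    by simp
qed

lemma deriv_Aut_disc_nonzero:
  assumes S: "S \<in> Aut_disc" and w: "w \<in> cball 0 1"
  shows "deriv S w \<noteq> 0"
proof -
  obtain a c where a: "norm a < 1" and c: "norm c = 1"
    and deq: "\<And>z. z \<in> cball 0 1 \<Longrightarrow> deriv S z = c * ((1 - (norm a)\<^sup>2) / (1 - cnj a * z)\<^sup>2)"
    using Aut_disc_Moebius_form[OF S] by metis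
  have "1 - (norm a)\<^sup>2 > 0"
    using a by (simp add: power_less_one_iff)
  then have "complex_of_real (1 - (norm a)\<^sup>2) \<noteq> 0"
    by (simp only: of_real_eq_0_iff)
  then show ?thesis
    using one_minus_cnj_mult_nonzero[OF a] c w by (auto simp: deq)
qed

lemma one_minus_norm_Aut_disc:
  assumes S: "S \<in> Aut_disc" and w: "w \<in> cball 0 1"
  shows "1 - (norm (S w))\<^sup>2 = norm (deriv S w) * (1 - (norm w)\<^sup>2)"
proof -
  obtain a c where a: "norm a < 1" and c: "norm c = 1"
    and eq: "\<And>z. z \<in> cball 0 1 \<Longrightarrow> S z = c * bracket z a"
    and deq: "\<And>z. z \<in> cball 0 1 \<Longrightarrow> deriv S z = c * ((1 - (norm a)\<^sup>2) / (1 - cnj a * z)\<^sup>2)"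
    using Aut_disc_Moebius_form[OF S] by metis
  define N where "N = 1 - (norm a)\<^sup>2"
  define d where "d = 1 - cnj a * w"
  have N: "N > 0"
    using a by (simp add: N_def power_less_one_iff)
  have sq: "cnj x * x = of_real ((norm x)\<^sup>2)" for x
    by (metis complex_norm_square mult.commute)
  have "complex_of_real (1 - (norm (bracket w a))\<^sup>2) = of_real (N * (1 - (norm w)\<^sup>2) / (norm d)\<^sup>2)"
    using one_minus_cnj_bracket_mult_bracket[OF a, of w w] w
    by (simp add: sq N_def d_def[symmetric] mult.commute[of d])
  then have "1 - (norm (bracket w a))\<^sup>2 = N * (1 - (norm w)\<^sup>2) / (norm d)\<^sup>2"
    by (simp only: of_real_eq_iff)
  moreover have "norm (deriv S w) = N / (norm d)\<^sup>2"
  proof -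
    have "deriv S w = c * (of_real N / d\<^sup>2)"
      by (simp add: deq[OF w] N_def d_def)
    then show ?thesis
      using N c by (simp add: norm_mult norm_divide norm_power)
  qed
  ultimately show ?thesis
    using c w by (simp add: eq norm_mult)
qed

section \<open>Hyperbolic difference quotients\<close>

lemma hyp_diff_cong_ball:
  assumes "\<And>z. z \<in> ball 0 1 \<Longrightarrow> f z = g z" and "z\<^sub>0 \<in> ball 0 1" and "z \<in> ball 0 1"
  shows "hyp_diff z\<^sub>0 f z = hyp_diff z\<^sub>0 g z"
proof -
  have "eventually (\<lambda>z. f z = g z) (nhds z\<^sub>0)"
    using eventually_nhds_in_open[of "ball 0 1" z\<^sub>0] assms(1,2)
    by (auto elim: eventually_mono)
  then have "deriv f z\<^sub>0 = deriv g z\<^sub>0"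
    by (rule deriv_cong_ev) simp
  then show ?thesis
    using assms by (simp add: hyp_diff_def)
qed

lemma H_disc_norm_le: "f \<in> H_disc \<Longrightarrow> z \<in> ball 0 1 \<Longrightarrow> norm (f z) \<le> 1"
  by (simp add: H_disc_def)

text \<open>Off the diagonal this is the invariance of the bracket in numerator and denominator; the
  phase of \<open>deriv T z\<^sub>0\<close> passes from the denominator to the front because it arises when
  \<open>bracket z z\<^sub>0\<close> is expressed by \<open>bracket (T z) (T z\<^sub>0)\<close>. On the diagonal it is the chain rule
  together with \<open>one_minus_norm_Aut_disc\<close>.\<close>

lemma hyp_diff_Aut_disc:
  assumes f: "f \<in> H_disc" and S: "S \<in> Aut_disc" and T: "T \<in> Aut_disc"
    and z0: "z\<^sub>0 \<in> ball 0 1" and z: "z \<in> ball 0 1"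
  shows "hyp_diff z\<^sub>0 (S \<circ> f \<circ> T) z =
    sgn (deriv S (f (T z\<^sub>0))) * sgn (deriv T z\<^sub>0) * hyp_diff (T z\<^sub>0) f (T z)"
proof -
  define w where "w = f (T z\<^sub>0)"
  have Tz: "T z \<in> ball 0 1" and Tz0: "T z\<^sub>0 \<in> ball 0 1"
    using Aut_disc_ball[OF T] z z0 by auto
  have w: "w \<in> cball 0 1" and fz: "f (T z) \<in> cball 0 1"
    using H_disc_norm_le[OF f] Tz Tz0 by (auto simp: w_def)
  have z0': "z\<^sub>0 \<in> cball 0 1" and z': "z \<in> cball 0 1"
    using z0 z by auto
  have S0: "deriv S w \<noteq> 0" and T0: "deriv T z\<^sub>0 \<noteq> 0"
    using deriv_Aut_disc_nonzero[OF S w] deriv_Aut_disc_nonzero[OF T z0'] by auto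
  show ?thesis
  proof (cases "z = z\<^sub>0")
    case True
    have "(f has_field_derivative deriv f (T z\<^sub>0)) (at (T z\<^sub>0))"
      using f Tz0 by (auto simp: H_disc_def intro: holomorphic_derivI)
    then have "(f \<circ> T has_field_derivative deriv f (T z\<^sub>0) * deriv T z\<^sub>0) (at z\<^sub>0)"
      by (rule DERIV_chain) (rule Aut_disc_has_field_derivative[OF T z0'])
    moreover have "(S has_field_derivative deriv S w) (at ((f \<circ> T) z\<^sub>0))"
      using Aut_disc_has_field_derivative[OF S w] by (simp add: w_def)
    ultimately have "(S \<circ> (f \<circ> T) has_field_derivative
        deriv S w * (deriv f (T z\<^sub>0) * deriv T z\<^sub>0)) (at z\<^sub>0)"
      by (rule DERIV_chain[rotated])
    then have "deriv (S \<circ> f \<circ> T) z\<^sub>0 = deriv S w * (deriv f (T z\<^sub>0) * deriv T z\<^sub>0)"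
      by (simp add: comp_assoc DERIV_imp_deriv)
    with True show ?thesis
      using S0 T0
      by (simp add: hyp_diff_def w_def[symmetric] sgn_eq one_minus_norm_Aut_disc[OF S w]
          one_minus_norm_Aut_disc[OF T z0'] del: of_real_diff)
  next
    case False
    then have "T z \<noteq> T z\<^sub>0"
      using T z z0 by (auto simp: Aut_disc_def bij_betw_def dest: inj_onD)
    moreover have "bracket (S (f (T z))) (S w) = sgn (deriv S w) * bracket (f (T z)) w"
      by (rule bracket_Aut_disc[OF S fz w])
    moreover have "bracket (T z) (T z\<^sub>0) = sgn (deriv T z\<^sub>0) * bracket z z\<^sub>0"
      by (rule bracket_Aut_disc[OF T z' z0'])
    ultimately show ?thesis
      using False T0 by (simp add: hyp_diff_def w_def[symmetric] sgn_zero_iff)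
  qed
qed

lemma H_disc_unimodular_imp_constant:
  assumes f: "f \<in> H_disc" and w: "w \<in> ball 0 1" "norm (f w) = 1" and z: "z \<in> ball 0 1"
  shows "f z = f w"
proof -
  have "f constant_on ball 0 1"
    by (rule maximum_modulus_principle[where U = "ball 0 1" and \<xi> = w])
       (use f w in \<open>auto simp: H_disc_def\<close>)
  then show ?thesis
    using z w by (auto simp: constant_on_def)
qed

text \<open>The singularity of the difference quotient at \<open>z\<^sub>0\<close> is removable, and the bound by \<open>1\<close> is
  the Schwarz--Pick lemma. By \<open>hyp_diff_Aut_disc\<close> one may move \<open>z\<^sub>0\<close> and \<open>f z\<^sub>0\<close> to \<open>0\<close>, which
  leaves the Schwarz lemma.\<close>

lemma hyp_diff_in_H_disc:
  assumes f: "f \<in> H_disc" and z0: "z\<^sub>0 \<in> ball 0 1"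
  shows "hyp_diff z\<^sub>0 f \<in> H_disc"
proof (cases "norm (f z\<^sub>0) = 1")
  case True
  have "hyp_diff z\<^sub>0 f z = 0" if "z \<in> ball 0 1" for z
    using H_disc_unimodular_imp_constant[OF f z0 True that] True
    by (simp add: hyp_diff_def bracket_def)
  then show ?thesis
    unfolding H_disc_def
    using holomorphic_transform[of "\<lambda>_. 0" "ball 0 1" "hyp_diff z\<^sub>0 f"] by auto
next
  case False
  let ?D = "ball 0 1 :: complex set"
  have holf: "f holomorphic_on ?D"
    using f by (simp add: H_disc_def)
  have lt: "norm (f z) < 1" if "z \<in> ?D" for z
    using H_disc_unimodular_imp_constant[OF f that _ z0] H_disc_norm_le[OF f that] False
    by fastforce
  define a where "a = f z\<^sub>0"
  have a: "norm a < 1"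
    using lt[OF z0] by (simp add: a_def)
  define F where "F = (\<lambda>z. bracket z a) \<circ> f"
  have holF: "F holomorphic_on ?D"
    unfolding F_def
    by (rule holomorphic_on_compose_gen[OF holf Aut_disc_holomorphic[OF bracket_in_Aut_disc[OF a]]])
       (use lt in auto)
  have "(F has_field_derivative (1 - (norm a)\<^sup>2) / (1 - cnj a * a)\<^sup>2 * deriv f z\<^sub>0) (at z\<^sub>0)"
    unfolding F_def
  proof (rule DERIV_chain)
    show "((\<lambda>z. bracket z a) has_field_derivative (1 - (norm a)\<^sup>2) / (1 - cnj a * a)\<^sup>2) (at (f z\<^sub>0))"
      using has_field_derivative_bracket[OF a, of a] a by (simp only: a_def less_imp_le)
    show "(f has_field_derivative deriv f z\<^sub>0) (at z\<^sub>0)"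
      by (rule holomorphic_derivI[OF holf open_ball z0])
  qed
  then have "deriv F z\<^sub>0 = (1 - (norm a)\<^sup>2) / (1 - cnj a * a)\<^sup>2 * deriv f z\<^sub>0"
    by (rule DERIV_imp_deriv)
  then have dF: "deriv F z\<^sub>0 = deriv f z\<^sub>0 / (1 - (norm a)\<^sup>2)"
    using one_minus_cnj_mult_nonzero[OF a, of a] a
    by (simp add: of_real_norm_squared power2_eq_square[of "1 - cnj a * a"] mult.commute[of a])
  \<comment> \<open>\<open>bracket z z\<^sub>0\<close> is \<open>z - z\<^sub>0\<close> divided by \<open>1 - cnj z\<^sub>0 * z\<close>, so the ordinary difference quotient of
    \<open>F\<close> times the latter is the hyperbolic one.\<close>
  define G where "G z = (if z = z\<^sub>0 then deriv F z\<^sub>0 else (F z - F z\<^sub>0) / (z - z\<^sub>0)) * (1 - cnj z\<^sub>0 * z)" for z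
  have "G holomorphic_on ?D"
    unfolding G_def using pole_lemma_open[OF holF open_ball, of z\<^sub>0] by (intro holomorphic_intros)
  moreover have "G z = hyp_diff z\<^sub>0 f z" for z
  proof -
    have "F x = bracket (f x) a" for x
      by (simp add: F_def)
    moreover from this have "F z\<^sub>0 = 0"
      by (simp add: bracket_def a_def)
    ultimately show ?thesis
      by (simp add: G_def hyp_diff_def dF a_def[symmetric] bracket_def[of z] of_real_norm_squared
          mult.commute)
  qed
  ultimately have hol: "hyp_diff z\<^sub>0 f holomorphic_on ?D"
    by (metis holomorphic_cong)
  have "norm (hyp_diff z\<^sub>0 f z) \<le> 1" if z: "z \<in> ?D" for z
  proof -
    define S where "S = (\<lambda>z. bracket z a)"
    define T where "T = (\<lambda>z. bracket z (- z\<^sub>0))"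
    have S: "S \<in> Aut_disc" and T: "T \<in> Aut_disc"
      using bracket_in_Aut_disc a z0 by (auto simp: S_def T_def)
    have T0: "T 0 = z\<^sub>0"
      by (simp add: T_def bracket_def)
    obtain y where y: "y \<in> ?D" and Ty: "T y = z"
      using T z by (metis (no_types, lifting) Aut_disc_def bij_betw_iff_bijections mem_Collect_eq)
    define g where "g = S \<circ> f \<circ> T"
    have holg: "g holomorphic_on ?D"
      unfolding g_def S_def F_def[symmetric]
      by (rule holomorphic_on_compose_gen[OF Aut_disc_holomorphic[OF T] holF])
         (use Aut_disc_ball[OF T] in auto)
    have g0: "g 0 = 0"
      by (simp add: g_def T0 S_def bracket_def a_def)
    have glt: "norm (g x) < 1" if "norm x < 1" for x
      using Aut_disc_ball[OF S] Aut_disc_ball[OF T, of x] lt that by (simp add: g_def)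
    have "norm (hyp_diff 0 g y) \<le> 1"
    proof (cases "y = 0")
      case True
      then show ?thesis
        using Schwarz_Lemma(2)[OF holg g0 glt, of 0] by (simp add: hyp_diff_def g0)
    next
      case False
      then show ?thesis
        using Schwarz_Lemma(1)[OF holg g0 glt, of y] y
        by (simp add: hyp_diff_def bracket_def g0 norm_divide divide_le_eq)
    qed
    moreover have "hyp_diff 0 g y = sgn (deriv S a) * sgn (deriv T 0) * hyp_diff z\<^sub>0 f z"
      using hyp_diff_Aut_disc[OF f S T, of 0 y] y by (simp add: g_def T0 Ty a_def)
    moreover have "deriv S a \<noteq> 0" "deriv T 0 \<noteq> 0"
      using deriv_Aut_disc_nonzero S T a by auto
    ultimately show ?thesis
      by (simp add: norm_mult norm_sgn)
  qed
  with hol show ?thesis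
    by (simp add: H_disc_def)
qed

lemma hyp_diffs_in_H_disc:
  assumes "f \<in> H_disc" and "\<And>k. k < j \<Longrightarrow> p k \<in> ball 0 1"
  shows "hyp_diffs f p j \<in> H_disc"
  using assms by (induction j) (auto intro: hyp_diff_in_H_disc)

section \<open>Iterated difference quotients under automorphisms\<close>

theorem lemma2p3:
  fixes f S T :: "complex \<Rightarrow> complex" and p :: "nat \<Rightarrow> complex" and z :: complex and j :: nat
  assumes "f \<in> H_disc" and "S \<in> Aut_disc" and "T \<in> Aut_disc"
    and "j \<ge> 1"
    and "\<And>k. k < j \<Longrightarrow> p k \<in> ball 0 1"
    and "z \<in> ball 0 1"
  shows "hyp_diffs (S \<circ> f \<circ> T) p j z =
           deriv S (f (T (p 0))) / of_real (norm (deriv S (f (T (p 0)))))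
           * hyp_diffs f (T \<circ> p) j (T z)
           * (\<Prod>k<j. deriv T (p k) / of_real (norm (deriv T (p k))))
         \<and> norm (hyp_diffs (S \<circ> f \<circ> T) p j z) = norm (hyp_diffs f (T \<circ> p) j (T z))"
proof -
  note f = assms(1) and S = assms(2) and T = assms(3)
  define s where "s = sgn (deriv S (f (T (p 0))))"
  define t where "t k = sgn (deriv T (p k))" for k
  have p0: "p 0 \<in> ball 0 1"
    using assms(4,5) by auto
  have s1: "norm s = 1"
    using deriv_Aut_disc_nonzero[OF S] H_disc_norm_le[OF f Aut_disc_ball[OF T p0]]
    by (simp add: s_def norm_sgn)
  have t1: "norm (t k) = 1" if "k < j" for k
    using deriv_Aut_disc_nonzero[OF T, of "p k"] assms(5)[OF that] by (simp add: t_def norm_sgn)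
  have main: "hyp_diffs (S \<circ> f \<circ> T) p i z = s * hyp_diffs f (T \<circ> p) i (T z) * (\<Prod>k<i. t k)"
    if "1 \<le> i" "i \<le> j" "z \<in> ball 0 1" for i z
    using that
  proof (induction i arbitrary: z rule: nat_induct_at_least)
    case base
    then show ?case
      using hyp_diff_Aut_disc[OF f S T p0, of z] by (simp add: s_def t_def o_def)
  next
    case (Suc i)
    \<comment> \<open>By the induction hypothesis the function to be differenced is \<open>R \<circ> h \<circ> T\<close> on the disc.\<close>
    define C where "C = s * (\<Prod>k<i. t k)"
    define R where "R = (\<lambda>w. C * w)"
    define h where "h = hyp_diffs f (T \<circ> p) i"
    have pi: "p i \<in> ball 0 1"
      using Suc.prems assms(5) by simp
    have h: "h \<in> H_disc"
      unfolding h_def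
      by (rule hyp_diffs_in_H_disc[OF f]) (use Suc.prems Aut_disc_ball[OF T] assms(5) in auto)
    have C1: "norm C = 1"
      using s1 t1 Suc.prems by (simp add: C_def norm_mult flip: prod_norm)
    then have R: "R \<in> Aut_disc"
      unfolding R_def by (rule rotation_in_Aut_disc)
    have "deriv R w = C" for w
      unfolding R_def by (rule DERIV_imp_deriv) (auto intro!: derivative_eq_intros)
    then have R': "sgn (deriv R w) = C" for w
      using C1 by (simp add: sgn_eq)
    have "hyp_diffs (S \<circ> f \<circ> T) p (Suc i) z = hyp_diff (p i) (R \<circ> h \<circ> T) z"
      unfolding hyp_diffs.simps
      by (rule hyp_diff_cong_ball) (use Suc pi in \<open>auto simp: R_def C_def h_def o_def mult_ac\<close>)
    also have "\<dots> = C * t i * hyp_diff (T (p i)) h (T z)"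
      using hyp_diff_Aut_disc[OF h R T pi] Suc.prems by (simp add: R' t_def)
    finally show ?case
      by (simp add: C_def h_def o_def mult_ac)
  qed
  have eq: "hyp_diffs (S \<circ> f \<circ> T) p j z = s * hyp_diffs f (T \<circ> p) j (T z) * (\<Prod>k<j. t k)"
    using main assms(4,6) by simp
  moreover have "norm (\<Prod>k<j. t k) = 1"
    using t1 by (simp flip: prod_norm)
  ultimately have "norm (hyp_diffs (S \<circ> f \<circ> T) p j z) = norm (hyp_diffs f (T \<circ> p) j (T z))"
    using s1 by (simp add: norm_mult)
  with eq show ?thesis
    by (simp add: s_def t_def sgn_eq)
qed

end
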